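(* Let $d\ge1$, let $\|\cdot\|$ be a norm on $\mathbb{R}^d$, let $\alpha>0$, and let $(\Theta_t)_{t\in\mathbb{Z}}$ be a time series with values in $\mathbb{R}^d$ which satisfies Property (TCF) and Property (SC) with parameter $\alpha$. Let $\|\Theta^\ast\|:=\sup_{t\in\mathbb{Z}}\|\Theta_t\|$ and $T^\ast:=\inf\{t\in\mathbb{Z}:\|\Theta_t\|=\|\Theta^\ast\|\}$. Then the conditional distribution of $(\Theta_t)_{t\in\mathbb{Z}}$ given (the $\sigma$-algebra generated by) $\left(\Theta_{T^\ast+t}/\|\Theta^\ast\|\right)_{t\in\mathbb{Z}}$ is $$\mathcal{L}\left((\Theta_t)_{t\in\mathbb{Z}}\,\middle|\,\left(\frac{\Theta_{T^\ast+t}}{\|\Theta^\ast\|}\right)_{t\in\mathbb{Z}}\right)=\sum_{k\in\mathbb{Z}}\frac{\|\Theta_{T^\ast+k}\|^\alpha}{\sum_{t\in\mathbb{Z}}\|\Theta_t\|^\alpha}\;\delta_{\left(\frac{\Theta_{T^\ast+k+t}}{\|\Theta_{T^\ast+k}\|}\right)_{t\in\mathbb{Z}}},$$ where $\delta_x$ denotes the Dirac measure at $x\in(\mathbb{R}^d)^{\mathbb{Z}}$.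
   Context: Property (SC) (with parameter $\alpha$): $0<\sum_{t\in\mathbb{Z}}\|\Theta_t\|^\alpha<\infty$ almost surely. Property (TCF) (with parameter $\alpha>0$): an $\mathbb{R}^d$-valued time series $(\Theta_t)_{t\in\mathbb{Z}}$ satisfies Property (TCF) if $P(\|\Theta_0\|=1)=1$ and $$E\big(f(\Theta_{s-i},\dots,\Theta_{t-i})\big)=E\left(f\left(\frac{\Theta_s}{\|\Theta_i\|},\dots,\frac{\Theta_t}{\|\Theta_i\|}\right)\mathbf{1}_{\{\|\Theta_i\|>0\}}\|\Theta_i\|^\alpha\right)$$ for all integers $s\le 0\le t$, all $i\in\mathbb{Z}$ and all bounded continuous $f:(\mathbb{R}^d)^{t-s+1}\to\mathbb{R}$ such that $f(\theta_s,\dots,\theta_t)=0$ whenever $\theta_0=0$ (the expression inside the right-hand expectation is $0$ where $\|\Theta_i\|=0$). Convention: a term containing the factor $\|\Theta_{T^\ast+k}\|^\alpha$ is interpreted as $0$ where $\|\Theta_{T^\ast+k}\|=0$. The conventions $\inf\mathbb{Z}=-\infty$ and $\inf\emptyset=\infty$ are used in defining $T^\ast$. *)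

theory Defs
  imports "HOL-Probability.Probability"
begin

section \<open>Norms and path space\<close>

definition is_norm :: "('v::real_vector \<Rightarrow> real) \<Rightarrow> bool" where
  "is_norm N \<longleftrightarrow>
     (\<forall>x. 0 \<le> N x) \<and> (\<forall>x. N x = 0 \<longleftrightarrow> x = 0) \<and>
     (\<forall>c x. N (c *\<^sub>R x) = \<bar>c\<bar> * N x) \<and> (\<forall>x y. N (x + y) \<le> N x + N y)"

abbreviation path_space :: "(int \<Rightarrow> 'v::topological_space) measure" where
  "path_space \<equiv> Pi\<^sub>M UNIV (\<lambda>_. borel)"

section \<open>Properties (TCF) and (SC)\<close>

text \<open>
  A tuple \<open>(\<theta>\<^sub>s, \<dots>, \<theta>\<^sub>t)\<close> is an extensional function on \<open>{s..t}\<close>, and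
  continuity of \<open>f\<close> is with respect to the product topology on these tuples.
  Where \<open>N (\<Theta> i \<omega>) = 0\<close> the indicator makes the right-hand integrand \<open>0\<close>.
\<close>

definition TCF ::
  "'w measure \<Rightarrow> ('v::real_normed_vector \<Rightarrow> real) \<Rightarrow> real \<Rightarrow> (int \<Rightarrow> 'w \<Rightarrow> 'v) \<Rightarrow> bool" where
  "TCF M N \<alpha> \<Theta> \<longleftrightarrow>
     (AE \<omega> in M. N (\<Theta> 0 \<omega>) = 1) \<and>
     (\<forall>s t i. \<forall>f :: (int \<Rightarrow> 'v) \<Rightarrow> real. s \<le> 0 \<longrightarrow> 0 \<le> t \<longrightarrow>
        continuous_map (product_topology (\<lambda>_. euclidean) {s..t}) euclideanreal f \<longrightarrow>
        bounded (f ` ({s..t} \<rightarrow>\<^sub>E UNIV)) \<longrightarrow>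
        (\<forall>\<theta> \<in> {s..t} \<rightarrow>\<^sub>E UNIV. \<theta> 0 = 0 \<longrightarrow> f \<theta> = 0) \<longrightarrow>
        (\<integral>\<omega>. f (\<lambda>j\<in>{s..t}. \<Theta> (j - i) \<omega>) \<partial>M) =
        (\<integral>\<omega>. f (\<lambda>j\<in>{s..t}. \<Theta> j \<omega> /\<^sub>R N (\<Theta> i \<omega>))
             * indicator {\<omega>. N (\<Theta> i \<omega>) > 0} \<omega> * N (\<Theta> i \<omega>) powr \<alpha> \<partial>M))"

definition path_power_sum :: "('v \<Rightarrow> real) \<Rightarrow> real \<Rightarrow> (int \<Rightarrow> 'v) \<Rightarrow> ennreal" where
  "path_power_sum N \<alpha> \<theta> = (\<Sum>\<^sub>\<infinity>t. ennreal (N (\<theta> t) powr \<alpha>))"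

definition SC :: "'w measure \<Rightarrow> ('v \<Rightarrow> real) \<Rightarrow> real \<Rightarrow> (int \<Rightarrow> 'w \<Rightarrow> 'v) \<Rightarrow> bool" where
  "SC M N \<alpha> \<Theta> \<longleftrightarrow>
     (AE \<omega> in M. 0 < path_power_sum N \<alpha> (\<lambda>t. \<Theta> t \<omega>) \<and> path_power_sum N \<alpha> (\<lambda>t. \<Theta> t \<omega>) < \<infinity>)"

section \<open>The supremum of the norms and its first time of attainment\<close>

definition path_sup :: "('v \<Rightarrow> real) \<Rightarrow> (int \<Rightarrow> 'v) \<Rightarrow> ereal" where
  "path_sup N \<theta> = (SUP t. ereal (N (\<theta> t)))"

text \<open>The infimum in \<^typ>\<open>ereal\<close> gives \<open>inf {} = \<infinity>\<close> and \<open>inf \<int> = - \<infinity>\<close>.\<close>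

definition T_star :: "('v \<Rightarrow> real) \<Rightarrow> (int \<Rightarrow> 'v) \<Rightarrow> ereal" where
  "T_star N \<theta> = (INF t\<in>{t. ereal (N (\<theta> t)) = path_sup N \<theta>}. ereal (real_of_int t))"

text \<open>
  \<open>from_T_star N \<theta> k\<close> is \<open>\<theta>\<close> at time \<open>T\<^sup>* + k\<close>. If \<open>T\<^sup>*\<close> is infinite, which under (SC)
  happens only on a null set, the value is set to \<open>0\<close>; if it is finite, it is an integer.
\<close>

definition from_T_star :: "('v::zero \<Rightarrow> real) \<Rightarrow> (int \<Rightarrow> 'v) \<Rightarrow> int \<Rightarrow> 'v" where
  "from_T_star N \<theta> k =
     (if \<bar>T_star N \<theta>\<bar> = \<infinity> then 0 else \<theta> (\<lfloor>real_of_ereal (T_star N \<theta>)\<rfloor> + k))"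

section \<open>Conditional distributions and mixtures of Dirac measures\<close>

text \<open>
  The random measure \<open>\<mu>\<close> on \<open>S\<close> is a version of the conditional distribution of \<open>X\<close> given
  the sub-\<open>\<sigma>\<close>-algebra \<open>F\<close>: up to a null set it is a probability kernel \<open>\<kappa>\<close> from \<open>F\<close> to \<open>S\<close>
  such that \<open>\<kappa> \<omega> A\<close> is a version of \<open>P (X \<in> A | F)\<close> for every measurable \<open>A\<close>.
\<close>

definition has_cond_distr ::
  "'w measure \<Rightarrow> ('w \<Rightarrow> 's) \<Rightarrow> 's measure \<Rightarrow> 'w measure \<Rightarrow> ('w \<Rightarrow> 's measure) \<Rightarrow> bool" where
  "has_cond_distr M X S F \<mu> \<longleftrightarrow>
     X \<in> M \<rightarrow>\<^sub>M S \<and> subalgebra M F \<and>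
     (\<exists>\<kappa> \<in> F \<rightarrow>\<^sub>M prob_algebra S.
        (\<forall>A\<in>sets S. AE \<omega> in M.
           measure (\<kappa> \<omega>) A = real_cond_exp M F (indicator (X -` A \<inter> space M)) \<omega>) \<and>
        (AE \<omega> in M. \<mu> \<omega> = \<kappa> \<omega>))"

definition dirac_mixture :: "'s measure \<Rightarrow> ('i \<Rightarrow> ennreal) \<Rightarrow> ('i \<Rightarrow> 's) \<Rightarrow> 's measure" where
  "dirac_mixture S w x =
     measure_of (space S) (sets S) (\<lambda>A. \<Sum>\<^sub>\<infinity>k. w k * emeasure (return S (x k)) A)"

end

(*
  Property (TCF) extends from bounded continuous functions to all measurable h >= 0 with h = 0 on
  {theta_0 = 0}. Apply it with shift i = k to

    h(theta) = 1_B(Z theta) 1_A(theta_{k+.}) |theta_0|^alpha / sum_t |theta_t|^alpha,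

  where Z theta = theta_{T*+.} / |theta*|. Since Z and |theta_0|^alpha / sum_t |theta_t|^alpha are
  invariant under positive scaling, and Z and the sum are invariant under shifts, this gives

    E[1_B(Z Theta) 1_A(Theta) p_{-k}] = E[1_B(Z Theta) 1_A(Theta_{k+.} / |Theta_k|) p_k],
    p_k = |Theta_k|^alpha / sum_t |Theta_t|^alpha.

  Summing over k yields P(Z Theta in B, Theta in A) = E[1_B(Z Theta) K(Theta, A)] for the mixture
  K(theta, .) of Dirac measures. As K is invariant under shift and scaling, K(Theta) = K(Z Theta).
*)
theory Submission
  imports Defs
begin

section \<open>Mixtures of Dirac measures\<close>

text \<open>Enumerating the integers by \<open>int_decode\<close> turns both sides into the same
  series. Integrals against counting measure then give access to monotone convergence and
  Tonelli.\<close>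

lemma infsum_int_eq_nn_integral:
  fixes f :: "int \<Rightarrow> ennreal"
  shows "(\<Sum>\<^sub>\<infinity>k. f k) = (\<integral>\<^sup>+k. f k \<partial>count_space UNIV)"
proof -
  have "(\<Sum>\<^sub>\<infinity>k. f k) = (\<Sum>\<^sub>\<infinity>n. f (int_decode n))"
    using infsum_reindex_bij_betw[of int_decode UNIV UNIV f] bij_int_decode by simp
  also have "\<dots> = (\<Sum>n. f (int_decode n))"
    by (intro sums_unique has_sum_imp_sums has_sum_infsum nonneg_summable_on_complete) simp
  also have "\<dots> = (\<integral>\<^sup>+n. f (int_decode n) \<partial>count_space UNIV)"
    by (simp add: nn_integral_count_space_nat)
  also have "\<dots> = (\<integral>\<^sup>+k. f k \<partial>count_space UNIV)"
    using nn_integral_bij_count_space[of int_decode UNIV UNIV f] bij_int_decode by simp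
  finally show ?thesis .
qed

text \<open>The mixture is the image under \<open>x\<close> of counting measure with density
  \<open>w\<close>. Hence the set function passed to \<open>measure_of\<close> is countably additive
  on \<open>sets S\<close>, and \<open>measure_of\<close> returns a measure with exactly these
  values.\<close>

lemma dirac_mixture_eq_distr:
  fixes x :: "int \<Rightarrow> 's"
  assumes x: "\<And>k. x k \<in> space S"
  shows "dirac_mixture S w x = distr (density (count_space UNIV) w) S x"
proof -
  let ?D = "distr (density (count_space UNIV) w) S x"
  have "(\<Sum>\<^sub>\<infinity>k. w k * emeasure (return S (x k)) A) = emeasure ?D A" if "A \<in> sets S" for A
    using that x
    by (simp add: infsum_int_eq_nn_integral emeasure_distr emeasure_density indicator_def
        cong: nn_integral_cong)
  then have "dirac_mixture S w x = measure_of (space S) (sets S) (emeasure ?D)"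
    unfolding dirac_mixture_def
    by (intro measure_of_eq) (auto simp: sets.space_closed sets.sigma_sets_eq)
  also have "\<dots> = ?D"
    using measure_of_of_measure[of ?D] by simp
  finally show ?thesis .
qed

lemma emeasure_dirac_mixture:
  fixes x :: "int \<Rightarrow> 's"
  assumes "\<And>k. x k \<in> space S" "A \<in> sets S"
  shows "emeasure (dirac_mixture S w x) A = (\<integral>\<^sup>+k. w k * indicator A (x k) \<partial>count_space UNIV)"
  using assms by (simp add: dirac_mixture_eq_distr emeasure_distr emeasure_density indicator_def
        cong: nn_integral_cong)

section \<open>Measurability on path space and reindexing of sums over the integers\<close>

lemma space_path_space [simp]: "space path_space = UNIV"
  by (simp add: space_PiM)

lemma measurable_path:
  assumes "\<And>t. (\<lambda>\<omega>. X \<omega> t) \<in> borel_measurable M"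
  shows "X \<in> M \<rightarrow>\<^sub>M path_space"
  using measurable_PiM_single'[of UNIV "\<lambda>t \<omega>. X \<omega> t" M "\<lambda>_. borel"] assms by simp

lemma borel_measurable_nn_integral_count_space [measurable (raw)]:
  fixes f :: "'a \<Rightarrow> int \<Rightarrow> ennreal"
  assumes "\<And>k. (\<lambda>x. f x k) \<in> borel_measurable M"
  shows "(\<lambda>x. \<integral>\<^sup>+k. f x k \<partial>count_space UNIV) \<in> borel_measurable M"
proof -
  have "(\<lambda>x. \<integral>\<^sup>+k. f x k \<partial>count_space UNIV) = (\<lambda>x. \<Sum>n. f x (int_decode n))"
    by (simp add: nn_integral_count_space_nat[symmetric]
        nn_integral_bij_count_space[OF bij_int_decode])
  then show ?thesis using assms by simp
qed

lemma nn_integral_int_shift: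
  fixes f :: "int \<Rightarrow> ennreal"
  shows "(\<integral>\<^sup>+k. f (k + c) \<partial>count_space UNIV) = (\<integral>\<^sup>+k. f k \<partial>count_space UNIV)"
proof (rule nn_integral_bij_count_space)
  show "bij (\<lambda>k. k + c)" by (rule bij_plus_right)
qed

lemma dirac_mixture_shift:
  fixes x :: "int \<Rightarrow> 's"
  assumes x: "\<And>k. x k \<in> space S"
  shows "dirac_mixture S (\<lambda>k. w (k + i)) (\<lambda>k. x (k + i)) = dirac_mixture S w x"
proof (rule measure_eqI)
  show "sets (dirac_mixture S (\<lambda>k. w (k + i)) (\<lambda>k. x (k + i))) = sets (dirac_mixture S w x)"
    using x by (simp add: dirac_mixture_eq_distr)
  fix A assume "A \<in> sets (dirac_mixture S (\<lambda>k. w (k + i)) (\<lambda>k. x (k + i)))"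
  then have "A \<in> sets S" using x by (simp add: dirac_mixture_eq_distr)
  then show "emeasure (dirac_mixture S (\<lambda>k. w (k + i)) (\<lambda>k. x (k + i))) A = emeasure (dirac_mixture S w x) A"
    using x nn_integral_int_shift[of "\<lambda>k. w k * indicator A (x k)" i]
    by (simp add: emeasure_dirac_mixture)
qed

section \<open>The first time of maximal norm\<close>

text \<open>The triangle inequality and homogeneity make \<open>N\<close> convex, and a finite
  convex function on a finite-dimensional space is continuous. This is needed because
  \<open>N\<close> is an arbitrary norm, not the \<open>norm\<close> of the type.\<close>

lemma is_norm_continuous_on:
  fixes N :: "'v::euclidean_space \<Rightarrow> real"
  assumes "is_norm N"
  shows "continuous_on UNIV N"
proof (rule convex_on_continuous[OF open_UNIV], rule convex_onI)
  fix t :: real and x y assume t: "0 < t" "t < 1"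
  have "N ((1 - t) *\<^sub>R x + t *\<^sub>R y) \<le> N ((1 - t) *\<^sub>R x) + N (t *\<^sub>R y)"
    using assms unfolding is_norm_def by blast
  also have "\<dots> = (1 - t) * N x + t * N y"
    using assms t by (simp add: is_norm_def)
  finally show "N ((1 - t) *\<^sub>R x + t *\<^sub>R y) \<le> (1 - t) * N x + t * N y" .
qed simp

text \<open>An integer-valued substitute for \<open>T_star\<close>: once such a \<open>T\<close>
  exists, the extended-real supremum and infimum can be replaced by ordinary values.\<close>

definition first_max :: "('v \<Rightarrow> real) \<Rightarrow> (int \<Rightarrow> 'v) \<Rightarrow> int \<Rightarrow> bool" where
  "first_max N \<theta> T \<longleftrightarrow> (\<forall>t. N (\<theta> t) \<le> N (\<theta> T)) \<and> (\<forall>t<T. N (\<theta> t) < N (\<theta> T))"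

lemma first_max_path_sup:
  assumes "first_max N \<theta> T"
  shows "path_sup N \<theta> = ereal (N (\<theta> T))"
  unfolding path_sup_def using assms by (intro SUP_eqI) (auto simp: first_max_def)

lemma first_max_T_star:
  assumes "first_max N \<theta> T"
  shows "T_star N \<theta> = ereal (of_int T)"
proof -
  have "T \<le> t" if "N (\<theta> t) = N (\<theta> T)" for t
    using assms that by (metis first_max_def less_irrefl not_le)
  then show ?thesis
    unfolding T_star_def first_max_path_sup[OF assms]
    by (intro INF_eqI) auto
qed

lemma first_max_from_T_star:
  assumes "first_max N \<theta> T"
  shows "from_T_star N \<theta> k = \<theta> (T + k)"
  by (simp add: from_T_star_def first_max_T_star[OF assms])

text \<open>The path that is conditioned on, as a function of the original path.\<close>

definition recentred :: "('v::real_vector \<Rightarrow> real) \<Rightarrow> (int \<Rightarrow> 'v) \<Rightarrow> int \<Rightarrow> 'v" where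
  "recentred N \<theta> t = from_T_star N \<theta> t /\<^sub>R real_of_ereal (path_sup N \<theta>)"

lemma first_max_recentred:
  assumes "first_max N \<theta> T"
  shows "recentred N \<theta> = (\<lambda>t. \<theta> (T + t) /\<^sub>R N (\<theta> T))"
  by (simp add: fun_eq_iff recentred_def first_max_from_T_star[OF assms] first_max_path_sup[OF assms])

section \<open>Paths with positive finite power sum under shifts and positive scaling\<close>

locale norm_power =
  fixes N :: "'v::euclidean_space \<Rightarrow> real" and \<alpha> :: real
  assumes is_norm: "is_norm N" and alpha_pos: "0 < \<alpha>"
begin

lemma N_nonneg [simp]: "0 \<le> N x"
  and N_eq_0_iff [simp]: "N x = 0 \<longleftrightarrow> x = 0"
  and N_scaleR [simp]: "N (c *\<^sub>R x) = \<bar>c\<bar> * N x"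
  using is_norm by (auto simp: is_norm_def)

lemma N_0 [simp]: "N 0 = 0"
  by simp

lemma N_pos_iff: "0 < N x \<longleftrightarrow> x \<noteq> 0"
  by (metis N_eq_0_iff N_nonneg less_eq_real_def less_irrefl)

lemma borel_measurable_N [measurable]: "N \<in> borel_measurable borel"
  by (rule borel_measurable_continuous_onI[OF is_norm_continuous_on[OF is_norm]])

abbreviation power_sum :: "(int \<Rightarrow> 'v) \<Rightarrow> ennreal" where
  "power_sum \<equiv> path_power_sum N \<alpha>"

lemma power_sum_eq: "power_sum \<theta> = (\<integral>\<^sup>+k. ennreal (N (\<theta> k) powr \<alpha>) \<partial>count_space UNIV)"
  by (simp add: path_power_sum_def infsum_int_eq_nn_integral)

lemma borel_measurable_power_sum [measurable]: "power_sum \<in> borel_measurable path_space"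
  unfolding power_sum_eq[abs_def] by measurable

lemma power_sum_shift_scale:
  assumes "0 \<le> c"
  shows "power_sum (\<lambda>t. c *\<^sub>R \<theta> (t + i)) = ennreal (c powr \<alpha>) * power_sum \<theta>"
  using assms nn_integral_int_shift[of "\<lambda>k. ennreal (N (\<theta> k) powr \<alpha>)" i]
  by (simp add: power_sum_eq powr_mult ennreal_mult nn_integral_cmult)

lemma first_max_shift_scale:
  assumes "first_max N \<theta> T" "0 < c"
  shows "first_max N (\<lambda>t. c *\<^sub>R \<theta> (t + i)) (T - i)"
  using assms by (auto simp: first_max_def)

text \<open>Property (SC) for a single path. The deterministic part of the argument is carried out
  for such paths.\<close>

definition good :: "(int \<Rightarrow> 'v) \<Rightarrow> bool" where
  "good \<theta> \<longleftrightarrow> 0 < power_sum \<theta> \<and> power_sum \<theta> < \<infinity>"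

lemma good_shift_scale:
  assumes "good \<theta>" "0 < c"
  shows "good (\<lambda>t. c *\<^sub>R \<theta> (t + i))"
  using assms
  by (auto simp: good_def power_sum_shift_scale ennreal_mult_less_top ennreal_zero_less_mult_iff)

text \<open>A finite power sum leaves only finitely many indices above any positive level, so the
  supremum is attained, and only finitely often. A positive power sum makes it nonzero.\<close>

lemma good_first_max:
  assumes "good \<theta>"
  obtains T where "first_max N \<theta> T" "0 < N (\<theta> T)"
proof -
  have fin: "finite {t. e \<le> N (\<theta> t)}" if "0 < e" for e
  proof (rule ccontr)
    assume inf: "infinite {t. e \<le> N (\<theta> t)}"
    \<comment> \<open>Every index in the level set contributes at least
      \<open>e powr \<alpha>\<close>, so infinitely many of them would make the power sum
      infinite.\<close>
    have "\<infinity> = (\<integral>\<^sup>+k. ennreal (e powr \<alpha>) * indicator {t. e \<le> N (\<theta> t)} k \<partial>count_space UNIV)"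
      using inf that by (subst nn_integral_cmult_indicator) (auto simp: ennreal_mult_top)
    also have "\<dots> \<le> power_sum \<theta>"
      unfolding power_sum_eq using that alpha_pos
      by (intro nn_integral_mono) (auto intro!: ennreal_leI powr_mono2 split: split_indicator)
    finally show False using assms by (simp add: good_def top.extremum_unique)
  qed
  obtain u where u: "0 < N (\<theta> u)"
  proof (rule ccontr)
    assume "\<not> thesis"
    then have "\<And>t. N (\<theta> t) = 0" using that by (metis N_pos_iff N_eq_0_iff)
    then have "power_sum \<theta> = 0" by (simp add: power_sum_eq)
    then show False using assms by (simp add: good_def)
  qed
  \<comment> \<open>Indices outside \<open>F\<close> lie below the level reached at
    \<open>u\<close>, so the maximum over the finite set \<open>F\<close> is global and all
    maximisers are in \<open>F\<close>.\<close>
  define F where "F = {t. N (\<theta> u) \<le> N (\<theta> t)}"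
  have F: "finite F" "u \<in> F" using fin[OF u] by (auto simp: F_def)
  define m where "m = Max ((\<lambda>t. N (\<theta> t)) ` F)"
  have m: "N (\<theta> t) \<le> m" for t
  proof (cases "t \<in> F")
    case True then show ?thesis using F by (auto simp: m_def)
  next
    case False
    then have "N (\<theta> t) \<le> N (\<theta> u)" by (simp add: F_def)
    also have "\<dots> \<le> m" using F by (auto simp: m_def)
    finally show ?thesis .
  qed
  have "m \<in> (\<lambda>t. N (\<theta> t)) ` F" unfolding m_def using F by (intro Max_in) auto
  then have ne: "{t\<in>F. N (\<theta> t) = m} \<noteq> {}" by auto
  define T where "T = Min {t\<in>F. N (\<theta> t) = m}"
  have T: "T \<in> F" "N (\<theta> T) = m"
    using Min_in[OF _ ne] F by (auto simp: T_def)
  have "N (\<theta> t) < m" if "t < T" for t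
  proof (rule ccontr)
    assume "\<not> N (\<theta> t) < m"
    then have "N (\<theta> t) = m" using m[of t] by simp
    moreover from this have "t \<in> F" using m[of u] by (simp add: F_def)
    ultimately have "T \<le> t" unfolding T_def using F by (intro Min_le) auto
    then show False using that by simp
  qed
  then have "first_max N \<theta> T" using m T by (auto simp: first_max_def)
  moreover have "0 < N (\<theta> T)" using u m[of u] T by simp
  ultimately show thesis by (rule that)
qed

text \<open>The first maximiser moves along with the shift, and the factor \<open>c\<close> cancels
  against the maximal norm.\<close>

lemma recentred_shift_scale:
  assumes "good \<theta>" "0 < c"
  shows "recentred N (\<lambda>t. c *\<^sub>R \<theta> (t + i)) = recentred N \<theta>"
proof -
  obtain T where T: "first_max N \<theta> T" using good_first_max[OF assms(1)] by blast
  have "T - i + t + i = T + t" for t by simp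
  then show ?thesis
    using assms(2)
    by (simp add: first_max_recentred[OF T] first_max_recentred[OF first_max_shift_scale[OF T assms(2)]]
        fun_eq_iff divide_inverse)
qed

lemma measurable_recentred [measurable]: "recentred N \<in> path_space \<rightarrow>\<^sub>M path_space"
proof -
  have sup [measurable]: "path_sup N \<in> borel_measurable path_space"
    unfolding path_sup_def[abs_def] by (intro borel_measurable_SUP) auto
  \<comment> \<open>The index set of the infimum depends on the path. Giving the other indices the
    value \<open>\<infinity>\<close> yields a countable infimum of measurable functions.\<close>
  have T_star: "T_star N = (\<lambda>\<theta>. INF t. if ereal (N (\<theta> t)) = path_sup N \<theta> then ereal (real_of_int t) else \<infinity>)"
    unfolding T_star_def
  proof (intro ext antisym INF_greatest)
    fix \<theta> t assume "t \<in> {t. ereal (N (\<theta> t)) = path_sup N \<theta>}"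
    then show "(INF t. if ereal (N (\<theta> t)) = path_sup N \<theta> then ereal (real_of_int t) else \<infinity>)
        \<le> ereal (real_of_int t)"
      by (intro INF_lower2[of t]) auto
  qed (auto intro: INF_lower)
  have T [measurable]: "T_star N \<in> borel_measurable path_space"
    unfolding T_star by measurable
  show ?thesis
  proof (rule measurable_path)
    fix t
    \<comment> \<open>Evaluation at a path-dependent time is measurable because that time takes
      countably many values.\<close>
    have "(\<lambda>\<theta>. \<theta> (\<lfloor>real_of_ereal (T_star N \<theta>)\<rfloor> + t)) \<in> borel_measurable path_space"
      by (rule measurable_compose_countable[where f="\<lambda>n \<theta>. \<theta> (n + t)"]) simp_all
    then show "(\<lambda>\<theta>. recentred N \<theta> t) \<in> borel_measurable path_space"
      unfolding recentred_def from_T_star_def by measurable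
  qed
qed

end

section \<open>Property (TCF) for measurable functions\<close>

text \<open>Continuous functions decreasing to the indicator of a closed set. The empty set is
  treated apart because \<open>infdist x {}\<close> is 0, which would give the value 1.\<close>

definition closed_approx :: "'a::metric_space set \<Rightarrow> nat \<Rightarrow> 'a \<Rightarrow> real" where
  "closed_approx C m x = (if C = {} then 0 else (1 - min 1 (infdist x C)) ^ m)"

lemma continuous_on_closed_approx: "continuous_on UNIV (closed_approx C m)"
  unfolding closed_approx_def by (cases "C = {}") (auto intro!: continuous_intros)

lemma closed_approx_bounds: "0 \<le> closed_approx C m x" "closed_approx C m x \<le> 1"
  by (auto simp: closed_approx_def infdist_nonneg intro!: power_le_one)

lemma closed_approx_tendsto:
  assumes "closed C"
  shows "(\<lambda>m. closed_approx C m x) \<longlonglongrightarrow> indicator C x"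
proof (cases "x \<in> C")
  case True
  then have "C \<noteq> {}" by blast
  with True show ?thesis by (simp add: closed_approx_def)
next
  case nonmem: False
  show ?thesis
  proof (cases "C = {}")
    case False
    then have "0 < infdist x C" using infdist_pos_not_in_closed[OF assms _ nonmem] by auto
    then have "(\<lambda>m. (1 - min 1 (infdist x C)) ^ m) \<longlonglongrightarrow> 0"
      by (intro LIMSEQ_power_zero) auto
    with False nonmem show ?thesis by (simp add: closed_approx_def)
  qed (simp add: closed_approx_def)
qed

text \<open>Closed boxes over symmetric windows form an intersection-stable generator of the product
  \<sigma>-algebra. Such windows contain time 0, as those in (TCF) do.\<close>

lemma path_measure_eqI:
  fixes \<mu> \<nu> :: "(int \<Rightarrow> 'v::topological_space) measure"
  assumes \<mu>: "finite_measure \<mu>" "sets \<mu> = sets path_space"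
    and \<nu>: "sets \<nu> = sets path_space"
    and eq: "\<And>n C. 0 \<le> n \<Longrightarrow> (\<And>j. closed (C j)) \<Longrightarrow>
      emeasure \<mu> {\<theta>. \<forall>j\<in>{-n..n}. \<theta> j \<in> C j} = emeasure \<nu> {\<theta>. \<forall>j\<in>{-n..n}. \<theta> j \<in> C j}"
  shows "\<mu> = \<nu>"
proof -
  define E :: "(int \<Rightarrow> 'v) set set" where
    "E = {{\<theta>. \<forall>j\<in>{-n..n}. \<theta> j \<in> C j} | n C. 0 \<le> n \<and> (\<forall>j. closed (C j))}"
  have E_I: "{\<theta>. \<forall>j\<in>{-n..n}. \<theta> j \<in> C j} \<in> E" if "0 \<le> n" "\<And>j. closed (C j)" for n C
    using that unfolding E_def by blast
  have "Int_stable E"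
  proof (rule Int_stableI)
    fix a b assume "a \<in> E" "b \<in> E"
    then obtain n C n' C' where a: "a = {\<theta>. \<forall>j\<in>{-n..n}. \<theta> j \<in> C j}" "0 \<le> n" "\<And>j. closed (C j)"
      and b: "b = {\<theta>. \<forall>j\<in>{-n'..n'}. \<theta> j \<in> C' j}" "0 \<le> n'" "\<And>j. closed (C' j)"
      unfolding E_def by blast
    \<comment> \<open>Padding with \<open>UNIV\<close> puts both boxes on the larger of the two
      windows.\<close>
    let ?D = "\<lambda>j. (if j \<in> {-n..n} then C j else UNIV) \<inter> (if j \<in> {-n'..n'} then C' j else UNIV)"
    have "{-n..n} \<subseteq> {-max n n'..max n n'}" "{-n'..n'} \<subseteq> {-max n n'..max n n'}"
      by auto
    then have "a \<inter> b = {\<theta>. \<forall>j\<in>{-max n n'..max n n'}. \<theta> j \<in> ?D j}"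
      unfolding a(1) b(1) Int_iff if_split_mem2 set_eq_iff mem_Collect_eq by blast
    then show "a \<inter> b \<in> E"
      using E_I[of "max n n'" ?D] a b by (auto simp: closed_Int)
  qed
  have E_meas: "E \<subseteq> sets path_space"
  proof
    fix a assume "a \<in> E"
    then obtain n C where a: "a = {\<theta>. \<forall>j\<in>{-n..n}. \<theta> j \<in> C j}" "\<And>j. closed (C j)"
      unfolding E_def by blast
    have [measurable]: "\<And>j. C j \<in> sets borel" using a(2) by (rule borel_closed)
    have "{\<theta> \<in> space path_space. \<forall>j\<in>{-n..n}. \<theta> j \<in> C j} \<in> sets path_space"
      by measurable
    then show "a \<in> sets path_space" by (simp add: a(1))
  qed
  \<comment> \<open>The boxes generate: a closed condition on the single coordinate \<open>i\<close>
    is a box over the window of radius \<open>\<bar>i\<bar>\<close>, so all coordinates are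
    measurable for \<open>sigma UNIV E\<close>.\<close>
  have "(\<lambda>\<theta>. \<theta> i) \<in> borel_measurable (sigma UNIV E)" for i
    unfolding borel_eq_closed
  proof (rule measurable_measure_of)
    fix C :: "'v set" assume "C \<in> {C. closed C}"
    then have "{\<theta>. \<forall>j\<in>{-\<bar>i\<bar>..\<bar>i\<bar>}. \<theta> j \<in> (if j = i then C else UNIV)} \<in> E"
      by (intro E_I) auto
    also have "{\<theta>. \<forall>j\<in>{-\<bar>i\<bar>..\<bar>i\<bar>}. \<theta> j \<in> (if j = i then C else UNIV)} = (\<lambda>\<theta>. \<theta> i) -` C \<inter> space (sigma UNIV E)"
      by auto
    finally show "(\<lambda>\<theta>. \<theta> i) -` C \<inter> space (sigma UNIV E) \<in> sets (sigma UNIV E)"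
      by auto
  qed auto
  then have "(\<lambda>\<theta>. \<theta>) \<in> sigma UNIV E \<rightarrow>\<^sub>M path_space"
    by (rule measurable_path)
  then have "sets path_space \<subseteq> sigma_sets UNIV E"
    using measurable_sets[of "\<lambda>\<theta>. \<theta>" "sigma UNIV E" path_space] by (auto simp: space_measure_of)
  moreover have "sigma_sets UNIV E \<subseteq> sets path_space"
    using sets.sigma_sets_subset[OF E_meas] by simp
  ultimately have sets: "sets path_space = sigma_sets UNIV E" by blast
  show ?thesis
  proof (rule measure_eqI_generator_eq[where \<Omega> = UNIV and A = "\<lambda>_. UNIV"])
    show "range (\<lambda>_::nat. UNIV) \<subseteq> E" using E_I[of 0 "\<lambda>_. UNIV"] by simp
    show "emeasure \<mu> X = emeasure \<nu> X" if "X \<in> E" for X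
      using that eq unfolding E_def by blast
  qed (use \<open>Int_stable E\<close> \<mu> \<nu> sets in \<open>auto simp: finite_measure.emeasure_finite\<close>)
qed

section \<open>From continuous test functions to nonnegative measurable functions\<close>

locale tcf_process = norm_power N \<alpha> + prob_space M
  for N :: "'v::euclidean_space \<Rightarrow> real" and \<alpha> :: real and M :: "'w measure" +
  fixes \<Theta> :: "int \<Rightarrow> 'w \<Rightarrow> 'v"
  assumes measurable_process [measurable]: "\<And>t. \<Theta> t \<in> borel_measurable M"
    and TCF: "TCF M N \<alpha> \<Theta>"
begin

lemma measurable_shifted [measurable]: "(\<lambda>\<omega> t. \<Theta> (t - i) \<omega>) \<in> M \<rightarrow>\<^sub>M path_space"
  by (rule measurable_path) simp

lemma measurable_rescaled [measurable]:
  "(\<lambda>\<omega> t. \<Theta> t \<omega> /\<^sub>R N (\<Theta> i \<omega>)) \<in> M \<rightarrow>\<^sub>M path_space"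
  by (rule measurable_path) measurable

lemma AE_norm_0: "AE \<omega> in M. N (\<Theta> 0 \<omega>) = 1"
  using TCF by (simp add: TCF_def)

text \<open>
  Test functions bounded by \<open>weight \<circ> (\<lambda>\<theta>. \<theta> 0)\<close> make both integrands in (TCF) bounded by \<open>1\<close>, so that
  neither Bochner integral is the junk value \<open>0\<close> of a non-integrable function.
\<close>

definition weight :: "'v \<Rightarrow> real" where
  "weight x = min 1 (N x powr \<alpha>)"

lemma weight_bounds: "0 \<le> weight x" "weight x \<le> 1"
  by (auto simp: weight_def)

lemma weight_0 [simp]: "weight 0 = 0"
  by (simp add: weight_def)

lemma weight_pos: "x \<noteq> 0 \<Longrightarrow> 0 < weight x"
  by (simp add: weight_def)

lemma continuous_on_weight: "continuous_on UNIV weight"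
  unfolding weight_def
  by (intro continuous_intros is_norm_continuous_on[OF is_norm] continuous_on_powr') (use alpha_pos in auto)

lemma borel_measurable_weight [measurable]: "weight \<in> borel_measurable borel"
  by (rule borel_measurable_continuous_onI[OF continuous_on_weight])

text \<open>Almost surely \<open>N (\<Theta> 0 \<omega>) = 1\<close>, so the weight is at most the
  inverse of the factor \<open>N (\<Theta> i \<omega>) powr \<alpha>\<close>. If that norm is 0, the
  product is 0.\<close>

lemma AE_weight_scaled_le: "AE \<omega> in M. weight (\<Theta> 0 \<omega> /\<^sub>R N (\<Theta> i \<omega>)) * N (\<Theta> i \<omega>) powr \<alpha> \<le> 1"
  using AE_norm_0
proof eventually_elim
  case (elim \<omega>)
  let ?n = "N (\<Theta> i \<omega>)"
  show ?case
  proof (cases "?n = 0")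
    case False
    then have n: "0 < ?n" using N_nonneg[of "\<Theta> i \<omega>"] by linarith
    then have "inverse ?n * ?n = 1" by (intro left_inverse less_imp_neq[symmetric])
    then have inv: "(inverse ?n) powr \<alpha> * ?n powr \<alpha> = 1"
      using n by (simp only: powr_mult[symmetric]) simp
    have "weight (\<Theta> 0 \<omega> /\<^sub>R ?n) \<le> (inverse ?n) powr \<alpha>"
      using elim n by (simp add: weight_def)
    then have "weight (\<Theta> 0 \<omega> /\<^sub>R ?n) * ?n powr \<alpha> \<le> (inverse ?n) powr \<alpha> * ?n powr \<alpha>"
      by (rule mult_right_mono) simp
    also have "\<dots> = 1" by (rule inv)
    finally show ?thesis .
  qed simp
qed

text \<open>The indicator of the box is a limit of products of \<open>closed_approx\<close>
  functions. Multiplied by the weight at time 0 these are admissible in (TCF), and dominated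
  convergence with bound 1 passes to the limit on both sides.\<close>

lemma TCF_closed_box:
  assumes n: "0 \<le> n" and C: "\<And>j. closed (C j)"
  defines "A \<equiv> {\<theta>. \<forall>j\<in>{-n..n}. \<theta> j \<in> C j}"
  shows "(\<integral>\<omega>. weight (\<Theta> (- i) \<omega>) * indicator A (\<lambda>t. \<Theta> (t - i) \<omega>) \<partial>M) =
    (\<integral>\<omega>. weight (\<Theta> 0 \<omega> /\<^sub>R N (\<Theta> i \<omega>)) * N (\<Theta> i \<omega>) powr \<alpha>
        * indicator A (\<lambda>t. \<Theta> t \<omega> /\<^sub>R N (\<Theta> i \<omega>)) \<partial>M)" (is "?L = ?R")
proof -
  let ?\<phi> = "\<lambda>m \<theta>. \<Prod>j\<in>{-n..n}. closed_approx (C j) m (\<theta> j)"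
  let ?f = "\<lambda>m \<theta>. weight (\<theta> 0) * ?\<phi> m \<theta>"
  have [measurable]: "closed_approx (C j) m \<in> borel_measurable borel" for j m
    by (rule borel_measurable_continuous_onI[OF continuous_on_closed_approx])
  have \<phi>_bounds: "0 \<le> ?\<phi> m \<theta>" "?\<phi> m \<theta> \<le> 1" for m \<theta>
    by (auto intro!: prod_nonneg prod_le_1 closed_approx_bounds)
  have \<phi>_lim: "(\<lambda>m. ?\<phi> m \<theta>) \<longlonglongrightarrow> indicator A \<theta>" for \<theta>
  proof -
    have "(\<lambda>m. ?\<phi> m \<theta>) \<longlonglongrightarrow> (\<Prod>j\<in>{-n..n}. indicator (C j) (\<theta> j))"
      by (intro tendsto_prod closed_approx_tendsto C)
    also have "(\<Prod>j\<in>{-n..n}. indicator (C j) (\<theta> j)) = (indicator A \<theta> :: real)"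
    proof (cases "\<theta> \<in> A")
      case False
      then obtain j where j: "j \<in> {-n..n}" "\<theta> j \<notin> C j" by (auto simp: A_def)
      then have "(\<Prod>j\<in>{-n..n}. indicator (C j) (\<theta> j)) = (0::real)"
        by (intro prod_zero) (auto intro!: bexI[of _ j])
      with False show ?thesis by simp
    qed (auto simp: A_def)
    finally show ?thesis .
  qed
  have [measurable]: "A \<in> sets path_space"
  proof -
    have [measurable]: "\<And>j. C j \<in> sets borel" using C by (rule borel_closed)
    have "{\<theta> \<in> space path_space. \<forall>j\<in>{-n..n}. \<theta> j \<in> C j} \<in> sets path_space" by measurable
    then show ?thesis by (simp add: A_def)
  qed
  have comp: "continuous_map (product_topology (\<lambda>_. euclidean) {-n..n}) euclideanreal (\<lambda>\<theta>. h (\<theta> j))"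
    if "continuous_on UNIV h" "j \<in> {-n..n}" for h :: "'v \<Rightarrow> real" and j
    using continuous_map_compose[OF continuous_map_product_projection[OF that(2), of "\<lambda>_. euclidean"], of euclideanreal h] that(1)
    by (simp add: o_def)
  have cont: "continuous_map (product_topology (\<lambda>_. euclidean) {-n..n}) euclideanreal (?f m)" for m
    using n by (intro continuous_map_real_mult continuous_map_prod comp continuous_on_weight
        continuous_on_closed_approx) auto
  have bdd: "bounded (?f m ` ({-n..n} \<rightarrow>\<^sub>E UNIV))" for m
    using \<phi>_bounds weight_bounds
    by (intro boundedI[where B = 1]) (auto simp: abs_mult intro!: mult_le_one)
  have TCF_f: "(\<integral>\<omega>. ?f m (\<lambda>t. \<Theta> (t - i) \<omega>) \<partial>M) =
      (\<integral>\<omega>. ?f m (\<lambda>t. \<Theta> t \<omega> /\<^sub>R N (\<Theta> i \<omega>)) * N (\<Theta> i \<omega>) powr \<alpha> \<partial>M)" for m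
  proof -
    \<comment> \<open>The test function reads only coordinates in the window, including 0 since
      \<open>0 \<le> n\<close>, so tuples may be replaced by full paths.\<close>
    have restr: "?f m (\<lambda>j\<in>{-n..n}. \<theta> j) = ?f m \<theta>" for \<theta>
      using n by (auto intro!: prod.cong)
    have "(\<integral>\<omega>. ?f m (\<lambda>j\<in>{-n..n}. \<Theta> (j - i) \<omega>) \<partial>M) =
        (\<integral>\<omega>. ?f m (\<lambda>j\<in>{-n..n}. \<Theta> j \<omega> /\<^sub>R N (\<Theta> i \<omega>))
             * indicator {\<omega>. N (\<Theta> i \<omega>) > 0} \<omega> * N (\<Theta> i \<omega>) powr \<alpha> \<partial>M)"
      using TCF[unfolded TCF_def, THEN conjunct2, rule_format, of "-n" n "?f m" i] n cont[of m] bdd[of m]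
      by simp
    also have "\<dots> = (\<integral>\<omega>. ?f m (\<lambda>j\<in>{-n..n}. \<Theta> j \<omega> /\<^sub>R N (\<Theta> i \<omega>)) * N (\<Theta> i \<omega>) powr \<alpha> \<partial>M)"
      \<comment> \<open>Where \<open>N (\<Theta> i \<omega>) = 0\<close> both integrands vanish, as
        \<open>0 powr \<alpha> = 0\<close>.\<close>
      by (intro Bochner_Integration.integral_cong) (auto simp: indicator_def N_pos_iff)
    finally show ?thesis unfolding restr .
  qed
  have "(\<lambda>m. \<integral>\<omega>. ?f m (\<lambda>t. \<Theta> (t - i) \<omega>) \<partial>M) \<longlonglongrightarrow> ?L"
  proof (rule integral_dominated_convergence[where w = "\<lambda>_. 1"])
    show "AE \<omega> in M. (\<lambda>m. ?f m (\<lambda>t. \<Theta> (t - i) \<omega>)) \<longlonglongrightarrow>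
        weight (\<Theta> (- i) \<omega>) * indicator A (\<lambda>t. \<Theta> (t - i) \<omega>)"
      by (auto intro!: AE_I2 tendsto_mult \<phi>_lim)
    show "AE \<omega> in M. norm (?f m (\<lambda>t. \<Theta> (t - i) \<omega>)) \<le> 1" for m
      using \<phi>_bounds weight_bounds by (intro AE_I2) (auto simp: abs_mult intro!: mult_le_one)
  qed measurable
  moreover have "(\<lambda>m. \<integral>\<omega>. ?f m (\<lambda>t. \<Theta> t \<omega> /\<^sub>R N (\<Theta> i \<omega>)) * N (\<Theta> i \<omega>) powr \<alpha> \<partial>M) \<longlonglongrightarrow> ?R"
  proof (rule integral_dominated_convergence[where w = "\<lambda>_. 1"])
    show "AE \<omega> in M. (\<lambda>m. ?f m (\<lambda>t. \<Theta> t \<omega> /\<^sub>R N (\<Theta> i \<omega>)) * N (\<Theta> i \<omega>) powr \<alpha>) \<longlonglongrightarrow>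
        weight (\<Theta> 0 \<omega> /\<^sub>R N (\<Theta> i \<omega>)) * N (\<Theta> i \<omega>) powr \<alpha> * indicator A (\<lambda>t. \<Theta> t \<omega> /\<^sub>R N (\<Theta> i \<omega>))"
    proof (rule AE_I2)
      fix \<omega>
      let ?x = "\<lambda>t. \<Theta> t \<omega> /\<^sub>R N (\<Theta> i \<omega>)" and ?c = "N (\<Theta> i \<omega>) powr \<alpha>"
      have "(\<lambda>m. weight (?x 0) * ?c * ?\<phi> m ?x) \<longlonglongrightarrow> weight (?x 0) * ?c * indicator A ?x"
        by (intro tendsto_mult tendsto_const \<phi>_lim)
      then show "(\<lambda>m. ?f m ?x * ?c) \<longlonglongrightarrow> weight (?x 0) * ?c * indicator A ?x"
        by (simp add: mult_ac)
    qed
    show "AE \<omega> in M. norm (?f m (\<lambda>t. \<Theta> t \<omega> /\<^sub>R N (\<Theta> i \<omega>)) * N (\<Theta> i \<omega>) powr \<alpha>) \<le> 1" for m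
      using AE_weight_scaled_le[of i]
    proof eventually_elim
      case (elim \<omega>)
      let ?x = "\<lambda>t. \<Theta> t \<omega> /\<^sub>R N (\<Theta> i \<omega>)" and ?c = "N (\<Theta> i \<omega>) powr \<alpha>"
      have "weight (?x 0) * ?c * ?\<phi> m ?x \<le> 1"
        by (rule mult_le_one[OF elim \<phi>_bounds])
      moreover have "0 \<le> ?f m ?x * ?c"
        using \<phi>_bounds weight_bounds by (intro mult_nonneg_nonneg) auto
      ultimately show ?case by (simp add: mult_ac)
    qed
  qed measurable
  ultimately show ?thesis
    unfolding TCF_f by (rule LIMSEQ_unique)
qed

text \<open>The two sides of \<open>TCF_closed_box\<close> are the masses of a closed box under
  these two measures, which therefore coincide by \<open>path_measure_eqI\<close>.\<close>

lemma TCF_weighted_distr: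
  "distr (density M (\<lambda>\<omega>. ennreal (weight (\<Theta> (- i) \<omega>)))) path_space (\<lambda>\<omega> t. \<Theta> (t - i) \<omega>) =
   distr (density M (\<lambda>\<omega>. ennreal (weight (\<Theta> 0 \<omega> /\<^sub>R N (\<Theta> i \<omega>)) * N (\<Theta> i \<omega>) powr \<alpha>)))
     path_space (\<lambda>\<omega> t. \<Theta> t \<omega> /\<^sub>R N (\<Theta> i \<omega>))" (is "?\<mu> = ?\<nu>")
proof -
  have \<mu>: "emeasure ?\<mu> A = ennreal (\<integral>\<omega>. weight (\<Theta> (- i) \<omega>) * indicator A (\<lambda>t. \<Theta> (t - i) \<omega>) \<partial>M)"
    if [measurable]: "A \<in> sets path_space" for A
  proof -
    have "emeasure ?\<mu> A = (\<integral>\<^sup>+\<omega>. ennreal (weight (\<Theta> (- i) \<omega>) * indicator A (\<lambda>t. \<Theta> (t - i) \<omega>)) \<partial>M)"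
      by (subst emeasure_distr, measurable, subst emeasure_density, measurable)
        (auto intro!: nn_integral_cong split: split_indicator)
    also have "\<dots> = ennreal (\<integral>\<omega>. weight (\<Theta> (- i) \<omega>) * indicator A (\<lambda>t. \<Theta> (t - i) \<omega>) \<partial>M)"
      using weight_bounds
      by (intro nn_integral_eq_integral integrable_const_bound[where B = 1])
        (auto simp: abs_mult intro!: AE_I2 mult_le_one split: split_indicator)
    finally show ?thesis .
  qed
  have \<nu>: "emeasure ?\<nu> A = ennreal (\<integral>\<omega>. weight (\<Theta> 0 \<omega> /\<^sub>R N (\<Theta> i \<omega>)) * N (\<Theta> i \<omega>) powr \<alpha>
        * indicator A (\<lambda>t. \<Theta> t \<omega> /\<^sub>R N (\<Theta> i \<omega>)) \<partial>M)"
    if [measurable]: "A \<in> sets path_space" for A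
  proof -
    let ?g = "\<lambda>\<omega>. weight (\<Theta> 0 \<omega> /\<^sub>R N (\<Theta> i \<omega>)) * N (\<Theta> i \<omega>) powr \<alpha>
        * indicator A (\<lambda>t. \<Theta> t \<omega> /\<^sub>R N (\<Theta> i \<omega>))"
    have "emeasure ?\<nu> A = (\<integral>\<^sup>+\<omega>. ennreal (?g \<omega>) \<partial>M)"
      by (subst emeasure_distr, measurable, subst emeasure_density, measurable)
        (auto intro!: nn_integral_cong split: split_indicator)
    also have "\<dots> = ennreal (\<integral>\<omega>. ?g \<omega> \<partial>M)"
    proof (intro nn_integral_eq_integral integrable_const_bound[where B = 1])
      show "AE \<omega> in M. norm (?g \<omega>) \<le> 1"
        using AE_weight_scaled_le[of i]
        by eventually_elim (use weight_bounds in \<open>auto split: split_indicator\<close>)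
    qed (use weight_bounds in auto)
    finally show ?thesis .
  qed
  show ?thesis
  proof (rule path_measure_eqI)
    show "finite_measure ?\<mu>"
      using \<mu>[OF sets.top] by (intro finite_measureI) simp
    fix n :: int and C :: "int \<Rightarrow> 'v set"
    assume nC: "0 \<le> n" "\<And>j. closed (C j)"
    have [measurable]: "\<And>j. C j \<in> sets borel" using nC(2) by (rule borel_closed)
    have "{\<theta> \<in> space path_space. \<forall>j\<in>{-n..n}. \<theta> j \<in> C j} \<in> sets path_space" by measurable
    then have "{\<theta>. \<forall>j\<in>{-n..n}. \<theta> j \<in> C j} \<in> sets path_space" by simp
    then show "emeasure ?\<mu> {\<theta>. \<forall>j\<in>{-n..n}. \<theta> j \<in> C j} = emeasure ?\<nu> {\<theta>. \<forall>j\<in>{-n..n}. \<theta> j \<in> C j}"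
      by (simp only: \<mu> \<nu> TCF_closed_box[OF nC])
  qed simp_all
qed

lemma TCF_nn_integral:
  assumes h [measurable]: "h \<in> borel_measurable path_space"
    and h0: "\<And>\<theta>. \<theta> 0 = 0 \<Longrightarrow> h \<theta> = 0"
  shows "(\<integral>\<^sup>+\<omega>. h (\<lambda>t. \<Theta> (t - i) \<omega>) \<partial>M) =
    (\<integral>\<^sup>+\<omega>. h (\<lambda>t. \<Theta> t \<omega> /\<^sub>R N (\<Theta> i \<omega>)) * ennreal (N (\<Theta> i \<omega>) powr \<alpha>) \<partial>M)"
proof -
  \<comment> \<open>Dividing out the weight reduces the claim to integrating \<open>g\<close>
    against the two equal measures. Where \<open>\<theta> 0 = 0\<close>, both the weight and
    \<open>h\<close> vanish, so weight times \<open>g\<close> is still \<open>h\<close>.\<close>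
  define g where "g \<theta> = h \<theta> / ennreal (weight (\<theta> 0))" for \<theta>
  have [measurable]: "g \<in> borel_measurable path_space"
    unfolding g_def[abs_def] by measurable
  have g: "ennreal (weight (\<theta> 0)) * g \<theta> = h \<theta>" for \<theta>
  proof (cases "\<theta> 0 = 0")
    case False
    then show ?thesis
      using weight_pos[OF False] by (simp add: g_def ennreal_times_divide mult.commute
          mult_divide_eq_ennreal)
  qed (simp add: h0)
  have "(\<integral>\<^sup>+\<omega>. h (\<lambda>t. \<Theta> (t - i) \<omega>) \<partial>M) =
      (\<integral>\<^sup>+\<omega>. ennreal (weight (\<Theta> (- i) \<omega>)) * g (\<lambda>t. \<Theta> (t - i) \<omega>) \<partial>M)"
    by (intro nn_integral_cong) (simp add: g[symmetric])
  also have "\<dots> = (\<integral>\<^sup>+\<theta>. g \<theta> \<partial>distr (density M (\<lambda>\<omega>. ennreal (weight (\<Theta> (- i) \<omega>))))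
      path_space (\<lambda>\<omega> t. \<Theta> (t - i) \<omega>))"
    by (simp add: nn_integral_distr nn_integral_density)
  also have "\<dots> = (\<integral>\<^sup>+\<omega>. ennreal (weight (\<Theta> 0 \<omega> /\<^sub>R N (\<Theta> i \<omega>)) * N (\<Theta> i \<omega>) powr \<alpha>)
      * g (\<lambda>t. \<Theta> t \<omega> /\<^sub>R N (\<Theta> i \<omega>)) \<partial>M)"
    unfolding TCF_weighted_distr by (simp add: nn_integral_distr nn_integral_density)
  also have "\<dots> = (\<integral>\<^sup>+\<omega>. h (\<lambda>t. \<Theta> t \<omega> /\<^sub>R N (\<Theta> i \<omega>)) * ennreal (N (\<Theta> i \<omega>) powr \<alpha>) \<partial>M)"
    by (intro nn_integral_cong) (simp add: g[symmetric] ennreal_mult weight_bounds mult_ac)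
  finally show ?thesis .
qed

end

section \<open>The kernel and the disintegration\<close>

context norm_power
begin

text \<open>The default Dirac measure on the remaining paths makes this a probability measure for
  every path, as a map into \<open>prob_algebra\<close> requires.\<close>

definition kernel :: "(int \<Rightarrow> 'v) \<Rightarrow> (int \<Rightarrow> 'v) measure" where
  "kernel \<theta> =
    (if good \<theta>
     then dirac_mixture path_space (\<lambda>k. ennreal (N (\<theta> k) powr \<alpha>) / power_sum \<theta>)
       (\<lambda>k t. \<theta> (k + t) /\<^sub>R N (\<theta> k))
     else return path_space (\<lambda>_. 0))"

lemma sets_kernel [simp]: "sets (kernel \<theta>) = sets path_space"
  by (simp add: kernel_def dirac_mixture_eq_distr)

lemma emeasure_kernel:
  assumes "good \<theta>" "A \<in> sets path_space"
  shows "emeasure (kernel \<theta>) A = (\<integral>\<^sup>+k. ennreal (N (\<theta> k) powr \<alpha>) / power_sum \<theta>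
    * indicator A (\<lambda>t. \<theta> (k + t) /\<^sub>R N (\<theta> k)) \<partial>count_space UNIV)"
  using assms by (simp add: kernel_def emeasure_dirac_mixture)

lemma good_divide_self: "good \<theta> \<Longrightarrow> power_sum \<theta> / power_sum \<theta> = 1"
  by (intro ennreal_divide_self) (auto simp: good_def)

lemma prob_space_kernel: "prob_space (kernel \<theta>)"
proof (cases "good \<theta>")
  case True
  have "emeasure (kernel \<theta>) (space path_space) = 1"
    using emeasure_kernel[OF True sets.top] good_divide_self[OF True]
    by (simp add: nn_integral_divide power_sum_eq[symmetric])
  moreover have "space (kernel \<theta>) = space path_space"
    by (rule sets_eq_imp_space_eq) simp
  ultimately show ?thesis by (intro prob_spaceI) simp
qed (auto simp: kernel_def intro!: prob_space_return)

lemma measurable_good [measurable]: "Measurable.pred path_space good"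
  unfolding good_def[abs_def] by measurable

lemma measurable_shift_rescale:
  "(\<lambda>\<theta> t. \<theta> (k + t) /\<^sub>R N (\<theta> k)) \<in> path_space \<rightarrow>\<^sub>M path_space"
  by (rule measurable_path) measurable

lemma measurable_shift: "(\<lambda>\<theta> t. \<theta> (t + k)) \<in> path_space \<rightarrow>\<^sub>M path_space"
  by (rule measurable_path) measurable

lemma measurable_kernel [measurable]: "kernel \<in> path_space \<rightarrow>\<^sub>M prob_algebra path_space"
proof (intro measurable_prob_algebraI prob_space_kernel measurable_subprob_algebra)
  fix A :: "(int \<Rightarrow> 'v) set" assume A [measurable]: "A \<in> sets path_space"
  have ind: "(\<lambda>\<theta>. indicator A (\<lambda>t. \<theta> (k + t) /\<^sub>R N (\<theta> k)) :: ennreal)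
      \<in> borel_measurable path_space" for k
    by (rule measurable_compose[OF measurable_shift_rescale borel_measurable_indicator[OF A]])
  have w: "(\<lambda>\<theta>. ennreal (N (\<theta> k) powr \<alpha>) / power_sum \<theta>) \<in> borel_measurable path_space" for k
    by measurable
  have sum: "(\<lambda>\<theta>. \<integral>\<^sup>+k. ennreal (N (\<theta> k) powr \<alpha>) / power_sum \<theta>
       * indicator A (\<lambda>t. \<theta> (k + t) /\<^sub>R N (\<theta> k)) \<partial>count_space UNIV) \<in> borel_measurable path_space"
    by (rule borel_measurable_nn_integral_count_space) (rule borel_measurable_times_ennreal[OF w ind])
  have "(\<lambda>\<theta>. emeasure (kernel \<theta>) A) =
    (\<lambda>\<theta>. if good \<theta> then \<integral>\<^sup>+k. ennreal (N (\<theta> k) powr \<alpha>) / power_sum \<theta>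
       * indicator A (\<lambda>t. \<theta> (k + t) /\<^sub>R N (\<theta> k)) \<partial>count_space UNIV
     else indicator A (\<lambda>_. 0))"
    by (rule ext) (auto simp: emeasure_kernel A, simp add: kernel_def A)
  also have "\<dots> \<in> borel_measurable path_space"
    by (rule measurable_If[OF sum]) measurable
  finally show "(\<lambda>\<theta>. emeasure (kernel \<theta>) A) \<in> borel_measurable path_space" .
qed (auto intro: prob_space_imp_subprob_space prob_space_kernel)

text \<open>A shift only reindexes the mixture. Scaling multiplies numerator and denominator of each
  weight by \<open>c powr \<alpha>\<close>, and cancels in the normalised atoms.\<close>

lemma kernel_shift_scale:
  assumes "good \<theta>" and c: "0 < c"
  shows "kernel (\<lambda>t. c *\<^sub>R \<theta> (t + i)) = kernel \<theta>"
proof -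
  let ?w = "\<lambda>k. ennreal (N (\<theta> k) powr \<alpha>) / power_sum \<theta>"
  let ?x = "\<lambda>k t. \<theta> (k + t) /\<^sub>R N (\<theta> k)"
  have "ennreal (N (c *\<^sub>R \<theta> (k + i)) powr \<alpha>) / power_sum (\<lambda>t. c *\<^sub>R \<theta> (t + i)) = ?w (k + i)" for k
  proof -
    have "ennreal (N (c *\<^sub>R \<theta> (k + i)) powr \<alpha>) = ennreal (c powr \<alpha>) * ennreal (N (\<theta> (k + i)) powr \<alpha>)"
      using c by (simp add: powr_mult ennreal_mult)
    then show ?thesis
      using c divide_mult_eq[of "ennreal (c powr \<alpha>)"]
      by (simp add: power_sum_shift_scale mult.commute[of "ennreal (c powr \<alpha>)"])
  qed
  moreover have "(c *\<^sub>R \<theta> (k + t + i)) /\<^sub>R N (c *\<^sub>R \<theta> (k + i)) = ?x (k + i) t" for k t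
    using c by (simp add: add_ac)
  ultimately show ?thesis
    using dirac_mixture_shift[of ?x path_space ?w i] good_shift_scale[OF assms] assms(1)
    by (simp add: kernel_def)
qed

lemma recentred_eq_shift_scale:
  assumes "good \<theta>"
  obtains T c where "0 < c" "recentred N \<theta> = (\<lambda>t. c *\<^sub>R \<theta> (t + T))"
proof -
  obtain T where T: "first_max N \<theta> T" "0 < N (\<theta> T)" using good_first_max[OF assms] by blast
  show thesis
    using that[of "inverse (N (\<theta> T))" T] T by (simp add: first_max_recentred add.commute)
qed

text \<open>The recentred path is a shifted positive multiple of the path, so the kernel depends on
  the recentred path alone. This is what makes it measurable for the conditioning
  \<sigma>-algebra.\<close>

lemma kernel_recentred:
  assumes "good \<theta>"
  shows "kernel (recentred N \<theta>) = kernel \<theta>"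
  using recentred_eq_shift_scale[OF assms] kernel_shift_scale[OF assms] by metis

text \<open>Indexing the mixture relative to the first maximiser \<open>T\<close> is a shift of the
  summation index, so the mixture is the kernel.\<close>

lemma dirac_mixture_from_T_star:
  assumes "good \<theta>"
  shows "dirac_mixture path_space (\<lambda>k. ennreal (N (from_T_star N \<theta> k) powr \<alpha>) / power_sum \<theta>)
       (\<lambda>k t. from_T_star N \<theta> (k + t) /\<^sub>R N (from_T_star N \<theta> k)) = kernel \<theta>"
proof -
  let ?x = "\<lambda>k t. \<theta> (k + t) /\<^sub>R N (\<theta> k)"
  obtain T where T: "first_max N \<theta> T" using good_first_max[OF assms] by blast
  have "\<theta> (T + (k + t)) = \<theta> (k + T + t)" for k t by (simp add: add_ac)
  then show ?thesis
    using dirac_mixture_shift[of ?x path_space "\<lambda>k. ennreal (N (\<theta> k) powr \<alpha>) / power_sum \<theta>" T] assms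
    by (simp add: kernel_def first_max_from_T_star[OF T] add.commute[of T])
qed

end

section \<open>Disintegration of the process along its recentred path\<close>

locale sc_process = tcf_process N \<alpha> M \<Theta>
  for N :: "'v::euclidean_space \<Rightarrow> real" and \<alpha> :: real and M :: "'w measure"
    and \<Theta> :: "int \<Rightarrow> 'w \<Rightarrow> 'v" +
  assumes SC: "SC M N \<alpha> \<Theta>"
begin

abbreviation path :: "'w \<Rightarrow> int \<Rightarrow> 'v" where
  "path \<omega> \<equiv> \<lambda>t. \<Theta> t \<omega>"

lemma AE_good: "AE \<omega> in M. good (path \<omega>)"
  using SC by (simp add: SC_def good_def)

lemma measurable_path_process [measurable]: "path \<in> M \<rightarrow>\<^sub>M path_space"
  by (rule measurable_path) simp

lemma TCF_recentred:
  assumes [measurable]: "A \<in> sets path_space" "B \<in> sets path_space"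
  shows "(\<integral>\<^sup>+\<omega>. indicator B (recentred N (path \<omega>)) * indicator A (path \<omega>)
      * (ennreal (N (\<Theta> (- k) \<omega>) powr \<alpha>) / power_sum (path \<omega>)) \<partial>M) =
    (\<integral>\<^sup>+\<omega>. indicator B (recentred N (path \<omega>))
      * (ennreal (N (\<Theta> k \<omega>) powr \<alpha>) / power_sum (path \<omega>)
         * indicator A (\<lambda>t. \<Theta> (k + t) \<omega> /\<^sub>R N (\<Theta> k \<omega>))) \<partial>M)" (is "?L = ?R")
proof -
  \<comment> \<open>The shift by \<open>k\<close> inside \<open>A\<close> undoes the shift of the
    path on the left of (TCF). The factor \<open>N (\<theta> 0) powr \<alpha>\<close> makes
    \<open>h\<close> vanish when \<open>\<theta> 0 = 0\<close>.\<close>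
  define h :: "(int \<Rightarrow> 'v) \<Rightarrow> ennreal" where
    "h \<theta> = indicator B (recentred N \<theta>) * indicator A (\<lambda>t. \<theta> (t + k))
       * (ennreal (N (\<theta> 0) powr \<alpha>) / power_sum \<theta>)" for \<theta>
  have [measurable]: "(\<lambda>\<theta>. indicator A (\<lambda>t. \<theta> (t + k)) :: ennreal) \<in> borel_measurable path_space"
    by (rule measurable_compose[OF measurable_shift borel_measurable_indicator]) fact
  have [measurable]: "h \<in> borel_measurable path_space"
    unfolding h_def[abs_def] by measurable
  have "?L = (\<integral>\<^sup>+\<omega>. h (\<lambda>t. \<Theta> (t - k) \<omega>) \<partial>M)"
  proof (rule nn_integral_cong_AE, use AE_good in eventually_elim)
    case (elim \<omega>)
    then show ?case
      using recentred_shift_scale[OF elim, of 1 "- k"] power_sum_shift_scale[of 1 "path \<omega>" "- k"]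
      by (simp add: h_def)
  qed
  also have "\<dots> = (\<integral>\<^sup>+\<omega>. h (\<lambda>t. \<Theta> t \<omega> /\<^sub>R N (\<Theta> k \<omega>)) * ennreal (N (\<Theta> k \<omega>) powr \<alpha>) \<partial>M)"
    by (rule TCF_nn_integral) (simp_all add: h_def)
  also have "\<dots> = ?R"
  proof (rule nn_integral_cong_AE, use AE_good AE_norm_0 in eventually_elim)
    case (elim \<omega>)
    show ?case
    proof (cases "\<Theta> k \<omega> = 0")
      case False
      define c where "c = inverse (N (\<Theta> k \<omega>))"
      have c: "0 < c" using False by (simp add: c_def N_pos_iff)
      have "power_sum (\<lambda>t. c *\<^sub>R \<Theta> t \<omega>) = ennreal (c powr \<alpha>) * power_sum (path \<omega>)"
        using c power_sum_shift_scale[of c "path \<omega>" 0] by simp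
      \<comment> \<open>As \<open>N (\<Theta> 0 \<omega>) = 1\<close>, the numerator is
        \<open>c powr \<alpha>\<close> and cancels. The factor
        \<open>N (\<Theta> k \<omega>) powr \<alpha>\<close> from (TCF) then supplies the numerator
        of the weight with index \<open>k\<close>.\<close>
      then have "ennreal (N (c *\<^sub>R \<Theta> 0 \<omega>) powr \<alpha>) / power_sum (\<lambda>t. c *\<^sub>R \<Theta> t \<omega>) = 1 / power_sum (path \<omega>)"
        using elim(2) c divide_mult_eq[of "ennreal (c powr \<alpha>)" 1 "power_sum (path \<omega>)"]
        by (simp add: mult.commute)
      moreover have "recentred N (\<lambda>t. c *\<^sub>R \<Theta> t \<omega>) = recentred N (path \<omega>)"
        using recentred_shift_scale[OF elim(1) c, of 0] by simp
      ultimately show ?thesis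
        by (simp add: h_def c_def[symmetric] add.commute[of k] divide_ennreal_def mult_ac)
    qed simp
  qed
  finally show ?thesis .
qed

text \<open>The weights sum to 1, so they can be inserted on the left. Tonelli brings the sum
  outside, \<open>TCF_recentred\<close> moves each weight from index \<open>- k\<close> to
  \<open>k\<close>, and Tonelli puts the sum back.\<close>

lemma kernel_disintegration:
  assumes [measurable]: "A \<in> sets path_space" "B \<in> sets path_space"
  shows "(\<integral>\<^sup>+\<omega>. indicator B (recentred N (path \<omega>)) * indicator A (path \<omega>) \<partial>M) =
    (\<integral>\<^sup>+\<omega>. indicator B (recentred N (path \<omega>)) * emeasure (kernel (path \<omega>)) A \<partial>M)"
proof -
  let ?w = "\<lambda>\<omega> k. ennreal (N (\<Theta> k \<omega>) powr \<alpha>) / power_sum (path \<omega>)"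
  have [measurable]: "(\<lambda>\<omega>. \<lambda>t. \<Theta> (k + t) \<omega> /\<^sub>R N (\<Theta> k \<omega>)) \<in> M \<rightarrow>\<^sub>M path_space" for k
    by (rule measurable_path) measurable
  have w: "(\<integral>\<^sup>+k. ?w \<omega> (- k) \<partial>count_space UNIV) = 1" if "good (path \<omega>)" for \<omega>
  proof -
    have "(\<integral>\<^sup>+k. ?w \<omega> (- k) \<partial>count_space UNIV) = (\<integral>\<^sup>+k. ?w \<omega> k \<partial>count_space UNIV)"
      by (rule nn_integral_bij_count_space[OF bij_uminus])
    also have "\<dots> = 1"
      using good_divide_self[OF that] by (simp add: nn_integral_divide power_sum_eq[symmetric])
    finally show ?thesis .
  qed
  have "(\<integral>\<^sup>+\<omega>. indicator B (recentred N (path \<omega>)) * indicator A (path \<omega>) \<partial>M) =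
    (\<integral>\<^sup>+\<omega>. \<integral>\<^sup>+k. indicator B (recentred N (path \<omega>)) * indicator A (path \<omega>) * ?w \<omega> (- k)
      \<partial>count_space UNIV \<partial>M)"
    using AE_good
    by (intro nn_integral_cong_AE, eventually_elim) (simp add: nn_integral_cmult w)
  also have "\<dots> = (\<integral>\<^sup>+k. \<integral>\<^sup>+\<omega>. indicator B (recentred N (path \<omega>)) * indicator A (path \<omega>) * ?w \<omega> (- k)
      \<partial>M \<partial>count_space UNIV)"
    by (rule nn_integral_count_space_nn_integral) simp_all
  also have "\<dots> = (\<integral>\<^sup>+k. \<integral>\<^sup>+\<omega>. indicator B (recentred N (path \<omega>)) *
      (?w \<omega> k * indicator A (\<lambda>t. \<Theta> (k + t) \<omega> /\<^sub>R N (\<Theta> k \<omega>))) \<partial>M \<partial>count_space UNIV)"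
    by (simp add: TCF_recentred)
  also have "\<dots> = (\<integral>\<^sup>+\<omega>. \<integral>\<^sup>+k. indicator B (recentred N (path \<omega>)) *
      (?w \<omega> k * indicator A (\<lambda>t. \<Theta> (k + t) \<omega> /\<^sub>R N (\<Theta> k \<omega>))) \<partial>count_space UNIV \<partial>M)"
    by (rule nn_integral_count_space_nn_integral[symmetric]) simp_all
  also have "\<dots> = (\<integral>\<^sup>+\<omega>. indicator B (recentred N (path \<omega>)) * emeasure (kernel (path \<omega>)) A \<partial>M)"
    using AE_good
    by (intro nn_integral_cong_AE, eventually_elim) (simp add: nn_integral_cmult emeasure_kernel)
  finally show ?thesis .
qed

text \<open>Every event of the conditioning \<sigma>-algebra is a preimage of some \<open>B\<close>
  under the recentred path, so \<open>kernel_disintegration\<close> is the defining identity of the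
  conditional probability.\<close>

lemma has_cond_distr_kernel:
  assumes \<mu>: "AE \<omega> in M. \<mu> \<omega> = kernel (path \<omega>)"
  shows "has_cond_distr M path path_space
    (vimage_algebra (space M) (\<lambda>\<omega>. recentred N (path \<omega>)) path_space) \<mu>"
proof -
  define Z where "Z = (\<lambda>\<omega>. recentred N (path \<omega>))"
  define F where "F = vimage_algebra (space M) Z path_space"
  have Z [measurable]: "Z \<in> M \<rightarrow>\<^sub>M path_space" unfolding Z_def by measurable
  have sets_F: "sets F = {Z -` B \<inter> space M | B. B \<in> sets path_space}"
    unfolding F_def by (rule sets_vimage_algebra2) simp
  have Z_F: "Z \<in> F \<rightarrow>\<^sub>M path_space"
    unfolding F_def by (rule measurable_vimage_algebra1) simp
  have subalg: "subalgebra M F"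
    unfolding subalgebra_def sets_F using measurable_sets[OF Z] by (auto simp: F_def)
  interpret finite_measure_subalgebra M F
    by unfold_locales (rule subalg)
  have \<kappa>_F: "(\<lambda>\<omega>. kernel (Z \<omega>)) \<in> F \<rightarrow>\<^sub>M prob_algebra path_space"
    by (rule measurable_compose[OF Z_F measurable_kernel])
  \<comment> \<open>The version built from \<open>Z\<close> is measurable for \<open>F\<close> by
    construction, and it agrees almost surely with the kernel of the path.\<close>
  have \<kappa>: "AE \<omega> in M. kernel (Z \<omega>) = kernel (path \<omega>)"
    using AE_good by eventually_elim (simp add: Z_def kernel_recentred)
  have cond: "AE \<omega> in M. measure (kernel (Z \<omega>)) A
      = real_cond_exp M F (indicator (path -` A \<inter> space M)) \<omega>"
    if A [measurable]: "A \<in> sets path_space" for A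
  proof -
    let ?f = "indicator (path -` A \<inter> space M) :: 'w \<Rightarrow> real"
    let ?g = "\<lambda>\<omega>. measure (kernel (Z \<omega>)) A"
    have g_F: "?g \<in> borel_measurable F"
      by (rule measurable_compose[OF \<kappa>_F measurable_measure_prob_algebra[OF A]])
    have g [measurable]: "?g \<in> borel_measurable M"
      by (rule measurable_from_subalg[OF subalg g_F])
    have g_le: "?g \<omega> \<le> 1" for \<omega>
      by (rule prob_space.prob_le_1[OF prob_space_kernel])
    have "AE \<omega> in M. real_cond_exp M F ?f \<omega> = ?g \<omega>"
    proof (rule real_cond_exp_charact)
      fix D assume "D \<in> sets F"
      then obtain B where D: "D = Z -` B \<inter> space M" and B [measurable]: "B \<in> sets path_space"
        unfolding sets_F by blast
      have [measurable]: "D \<in> sets M" unfolding D by measurable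
      have "(\<integral>\<^sup>+\<omega>. ennreal (indicator D \<omega> * ?f \<omega>) \<partial>M) =
          (\<integral>\<^sup>+\<omega>. indicator B (Z \<omega>) * indicator A (path \<omega>) \<partial>M)"
        by (intro nn_integral_cong) (auto simp: D indicator_def)
      also have "\<dots> = (\<integral>\<^sup>+\<omega>. indicator B (Z \<omega>) * emeasure (kernel (path \<omega>)) A \<partial>M)"
        unfolding Z_def by (rule kernel_disintegration) measurable
      also have "\<dots> = (\<integral>\<^sup>+\<omega>. ennreal (indicator D \<omega> * ?g \<omega>) \<partial>M)"
      proof (rule nn_integral_cong_AE, use \<kappa> AE_space in eventually_elim)
        fix \<omega> assume "kernel (Z \<omega>) = kernel (path \<omega>)" "\<omega> \<in> space M"
        moreover have "emeasure (kernel (Z \<omega>)) A = ennreal (?g \<omega>)"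
          using prob_space_kernel finite_measure.emeasure_eq_measure prob_space.finite_measure by metis
        ultimately show "indicator B (Z \<omega>) * emeasure (kernel (path \<omega>)) A = ennreal (indicator D \<omega> * ?g \<omega>)"
          by (simp add: D indicator_def)
      qed
      finally have "(\<integral>\<^sup>+\<omega>. ennreal (indicator D \<omega> * ?f \<omega>) \<partial>M) = (\<integral>\<^sup>+\<omega>. ennreal (indicator D \<omega> * ?g \<omega>) \<partial>M)" .
      \<comment> \<open>Both integrands are nonnegative, so equal extended integrals give equal
        Bochner integrals.\<close>
      then show "(\<integral>\<omega>\<in>D. ?f \<omega> \<partial>M) = (\<integral>\<omega>\<in>D. ?g \<omega> \<partial>M)"
        unfolding set_lebesgue_integral_def by (simp add: integral_eq_nn_integral)
    next
      show "integrable M ?f"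
        using measurable_sets[OF measurable_path_process A] by (simp add: less_top[symmetric])
      show "integrable M ?g"
        using g_le by (intro integrable_const_bound[where B = 1]) auto
    qed (rule g_F)
    then show ?thesis by eventually_elim simp
  qed
  show ?thesis
    unfolding has_cond_distr_def Z_def[symmetric] F_def[symmetric]
  proof (intro conjI bexI[of _ "\<lambda>\<omega>. kernel (Z \<omega>)"] ballI)
    show "AE \<omega> in M. \<mu> \<omega> = kernel (Z \<omega>)"
      using \<mu> \<kappa> by eventually_elim simp
  qed (use subalg \<kappa>_F cond in auto)
qed

end

theorem proposition3p6:
  fixes M :: "'w measure"
    and N :: "real ^ 'd \<Rightarrow> real"
    and \<alpha> :: real
    and \<Theta> :: "int \<Rightarrow> 'w \<Rightarrow> real ^ 'd"
  assumes "prob_space M"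
    and "is_norm N"
    and "\<alpha> > 0"
    and "\<And>t. \<Theta> t \<in> borel_measurable M"
    and "TCF M N \<alpha> \<Theta>"
    and "SC M N \<alpha> \<Theta>"
  shows "has_cond_distr M (\<lambda>\<omega> t. \<Theta> t \<omega>) path_space
    (vimage_algebra (space M)
       (\<lambda>\<omega> t. from_T_star N (\<lambda>j. \<Theta> j \<omega>) t /\<^sub>R real_of_ereal (path_sup N (\<lambda>j. \<Theta> j \<omega>)))
       path_space)
    (\<lambda>\<omega>. dirac_mixture path_space
       (\<lambda>k. ennreal (N (from_T_star N (\<lambda>j. \<Theta> j \<omega>) k) powr \<alpha>)
              / path_power_sum N \<alpha> (\<lambda>t. \<Theta> t \<omega>))
       (\<lambda>k t. from_T_star N (\<lambda>j. \<Theta> j \<omega>) (k + t)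
                /\<^sub>R N (from_T_star N (\<lambda>j. \<Theta> j \<omega>) k)))"
proof -
  interpret prob_space M by fact
  interpret sc_process N \<alpha> M \<Theta>
    by unfold_locales (use assms in auto)
  show ?thesis
    unfolding recentred_def[symmetric]
    by (rule has_cond_distr_kernel) (use AE_good in eventually_elim, simp add: dirac_mixture_from_T_star)
qed

end
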